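(* Let $A\in\mathbb{R}^{n\times n}$ and $b\in\mathbb{R}^n$ satisfy $\operatorname{sym}(A)\succeq I$, and suppose the solution set $S=\{x\in\mathbb{R}^n:\Phi(x)=0\}$ of $\Phi(x):=Ax-|x|-b=0$ is nonempty. Let $0<\rho<1$, $\epsilon>0$, $x^0\in\mathbb{R}^n$, and consider the CPPC method described in the context. Then for every $x^*\in S$ and every nonterminal iteration $k$ (that is, every iteration reached with $R(x^k)\neq 0$), $$\|x^{k+1}-x^*\|^2\le\|x^k-x^*\|^2-\frac{\langle v^k,d^k\rangle^2}{\|v^k\|^2}.$$
   Context: $|x|$ is the componentwise absolute value; $\langle\cdot,\cdot\rangle$, $\|\cdot\|$ are the Euclidean inner product and norm; $\operatorname{sym}(A)=(A+A^\top)/2$; $I$ is the identity; $M\succeq N$ means $M-N$ is positive semidefinite. For $t\in\mathbb{R}$ put $t^-=\max\{-t,0\}$ and $g(t)=(t^-)^2$. Let $F(x)=(A-I)x-b$. Given $0<\rho<1$ and $\epsilon>0$, set $\ell_i=\max\{a_{ii}-1,\epsilon\}$ and $\gamma_i=\rho/\ell_i$ for $i=1,\dots,n$. For $\gamma>0$ and $z\in\mathbb{R}$, $\operatorname{prox}_{\gamma g}(z)=\arg\min_{t\in\mathbb{R}}\{g(t)+(2\gamma)^{-1}|t-z|^2\}$; explicitly, $\operatorname{prox}_{\gamma g}(z)=z$ if $z\ge0$ and $z/(1+2\gamma)$ if $z<0$. The coordinate proximal residual is $R(x)=(R_i(x))_{i=1}^n$ with $R_i(x)=\gamma_i^{-1}\bigl[x_i-\operatorname{prox}_{\gamma_i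 g}(x_i-\gamma_iF_i(x))\bigr]$. CPPC method: from an arbitrary $x^0\in\mathbb{R}^n$, for $k=0,1,2,\dots$: choose any $i_k\in\arg\max_{1\le i\le n}|R_i(x^k)|$. If $R_{i_k}(x^k)=0$, terminate and return $x^k$. Otherwise define $y^k$ by $y^k_j=x^k_j$ for $j\ne i_k$ and $y^k_{i_k}=\operatorname{prox}_{\gamma_{i_k}g}(x^k_{i_k}-\gamma_{i_k}F_{i_k}(x^k))$; set $d^k=x^k-y^k$, $v^k=\Phi(y^k)$, $\lambda_k=\langle v^k,d^k\rangle/\|v^k\|^2$, and $x^{k+1}=x^k-\lambda_kv^k$. *)

theory Defs
  imports "HOL-Analysis.Analysis"
begin

definition sym_part :: "real^'n^'n \<Rightarrow> real^'n^'n" where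
  "sym_part A = (1/2) *\<^sub>R (A + transpose A)"

definition pos_semidef :: "real^'n^'n \<Rightarrow> bool" where
  "pos_semidef M \<longleftrightarrow> transpose M = M \<and> (\<forall>x. 0 \<le> x \<bullet> (M *v x))"

definition loewner_ge :: "real^'n^'n \<Rightarrow> real^'n^'n \<Rightarrow> bool" where
  "loewner_ge M N \<longleftrightarrow> pos_semidef (M - N)"

text \<open>The library's \<open>\<bar>x\<bar>\<close> on \<open>real^'n\<close> is the componentwise absolute value:\<close>

lemma abs_vec_nth: "\<bar>x :: real^'n\<bar> $ i = \<bar>x $ i\<bar>"
  by (simp add: abs_vec_def)

definition Phi :: "real^'n^'n \<Rightarrow> real^'n \<Rightarrow> real^'n \<Rightarrow> real^'n" where
  "Phi A b x = A *v x - \<bar>x\<bar> - b"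

definition solution_set :: "real^'n^'n \<Rightarrow> real^'n \<Rightarrow> (real^'n) set" where
  "solution_set A b = {x. Phi A b x = 0}"

definition neg_part :: "real \<Rightarrow> real" where
  "neg_part t = max (- t) 0"

definition g :: "real \<Rightarrow> real" where
  "g t = (neg_part t)\<^sup>2"

text \<open>\<open>arg_min\<close> selects some minimiser; for \<open>g\<close> and \<open>\<gamma> > 0\<close> it is unique, see \<open>prox_g\<close>.\<close>

definition prox :: "real \<Rightarrow> (real \<Rightarrow> real) \<Rightarrow> real \<Rightarrow> real" where
  "prox \<gamma> f z = (ARG_MIN (\<lambda>t. f t + \<bar>t - z\<bar>\<^sup>2 / (2 * \<gamma>)) t. True)"

lemma is_arg_min_prox_g:
  assumes "\<gamma> > 0"
  shows "is_arg_min (\<lambda>t. g t + \<bar>t - z\<bar>\<^sup>2 / (2 * \<gamma>)) (\<lambda>_. True) t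
    \<longleftrightarrow> t = (if z \<ge> 0 then z else z / (1 + 2 * \<gamma>))"
proof -
  define p where "p = (if z \<ge> 0 then z else z / (1 + 2 * \<gamma>))"
  define h where "h t = g t + \<bar>t - z\<bar>\<^sup>2 / (2 * \<gamma>)" for t
  have pz: "(p - z) / \<gamma> = 2 * neg_part p"
    using assms by (auto simp: p_def neg_part_def field_simps max_def)
  have g_ge: "g s \<ge> g p - 2 * neg_part p * (s - p)" for s
  proof (cases "p \<ge> 0")
    case True then show ?thesis by (simp add: g_def neg_part_def)
  next
    case False
    have "0 \<le> (s - p)\<^sup>2" by simp
    moreover have "p * s \<le> 0" if "s \<ge> 0" using False that by (simp add: mult_nonpos_nonneg)
    ultimately show ?thesis using False
      by (cases "s \<ge> 0") (auto simp: g_def neg_part_def max_def power2_eq_square algebra_simps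
          intro: order_trans[OF _ zero_le_square[of p]])
  qed
  have h_ge: "h s \<ge> h p + (s - p)\<^sup>2 / (2 * \<gamma>)" for s
  proof -
    have "(s - z)\<^sup>2 / (2 * \<gamma>) = (p - z)\<^sup>2 / (2 * \<gamma>) + (s - p)\<^sup>2 / (2 * \<gamma>) + ((p - z) / \<gamma>) * (s - p)"
      using assms by (simp add: field_simps power2_eq_square)
    then show ?thesis using g_ge[of s] by (simp add: h_def pz)
  qed
  have "is_arg_min h (\<lambda>_. True) t \<longleftrightarrow> t = p"
  proof
    assume "is_arg_min h (\<lambda>_. True) t"
    then have "h t \<le> h p" by (simp add: is_arg_min_linorder)
    with h_ge[of t] have "(t - p)\<^sup>2 / (2 * \<gamma>) \<le> 0" by simp
    then show "t = p" using assms by (simp add: divide_le_0_iff)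
  next
    assume "t = p"
    have "h p \<le> h s" for s
      using h_ge[of s] assms by (smt (verit) divide_nonneg_pos zero_le_power2)
    then show "is_arg_min h (\<lambda>_. True) t" by (simp add: is_arg_min_linorder \<open>t = p\<close>)
  qed
  then show ?thesis unfolding h_def p_def .
qed

lemma prox_g:
  assumes "\<gamma> > 0"
  shows "prox \<gamma> g z = (if z \<ge> 0 then z else z / (1 + 2 * \<gamma>))"
proof -
  have "is_arg_min (\<lambda>t. g t + \<bar>t - z\<bar>\<^sup>2 / (2 * \<gamma>)) (\<lambda>_. True)
      = (\<lambda>t. t = (if z \<ge> 0 then z else z / (1 + 2 * \<gamma>)))"
    by (rule ext) (rule is_arg_min_prox_g[OF assms])
  then show ?thesis unfolding prox_def arg_min_def by simp
qed

definition F :: "real^'n^'n \<Rightarrow> real^'n \<Rightarrow> real^'n \<Rightarrow> real^'n" where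
  "F A b x = (A - mat 1) *v x - b"

definition ell :: "real^'n^'n \<Rightarrow> real \<Rightarrow> 'n \<Rightarrow> real" where
  "ell A \<epsilon> i = max (A $ i $ i - 1) \<epsilon>"

definition gam :: "real^'n^'n \<Rightarrow> real \<Rightarrow> real \<Rightarrow> 'n \<Rightarrow> real" where
  "gam A \<rho> \<epsilon> i = \<rho> / ell A \<epsilon> i"

definition coord_prox ::
  "real^'n^'n \<Rightarrow> real^'n \<Rightarrow> real \<Rightarrow> real \<Rightarrow> real^'n \<Rightarrow> 'n \<Rightarrow> real" where
  "coord_prox A b \<rho> \<epsilon> x i = prox (gam A \<rho> \<epsilon> i) g (x $ i - gam A \<rho> \<epsilon> i * F A b x $ i)"

definition residual ::
  "real^'n^'n \<Rightarrow> real^'n \<Rightarrow> real \<Rightarrow> real \<Rightarrow> real^'n \<Rightarrow> real^'n" where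
  "residual A b \<rho> \<epsilon> x = (\<chi> i. inverse (gam A \<rho> \<epsilon> i) * (x $ i - coord_prox A b \<rho> \<epsilon> x i))"

definition cppc_y ::
  "real^'n^'n \<Rightarrow> real^'n \<Rightarrow> real \<Rightarrow> real \<Rightarrow> 'n \<Rightarrow> real^'n \<Rightarrow> real^'n" where
  "cppc_y A b \<rho> \<epsilon> i x = (\<chi> j. if j = i then coord_prox A b \<rho> \<epsilon> x i else x $ j)"

definition cppc_d ::
  "real^'n^'n \<Rightarrow> real^'n \<Rightarrow> real \<Rightarrow> real \<Rightarrow> 'n \<Rightarrow> real^'n \<Rightarrow> real^'n" where
  "cppc_d A b \<rho> \<epsilon> i x = x - cppc_y A b \<rho> \<epsilon> i x"

definition cppc_v ::
  "real^'n^'n \<Rightarrow> real^'n \<Rightarrow> real \<Rightarrow> real \<Rightarrow> 'n \<Rightarrow> real^'n \<Rightarrow> real^'n" where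
  "cppc_v A b \<rho> \<epsilon> i x = Phi A b (cppc_y A b \<rho> \<epsilon> i x)"

text \<open>The division is proper at nonterminal iterations: with \<open>i\<close>, \<open>v\<close>, \<open>d\<close> the index and vectors of
  the iteration, \<open>v\<^sub>i = (1 / \<gamma>\<^sub>i - (a\<^sub>i\<^sub>i - 1)) d\<^sub>i\<close>, where the factor is positive and \<open>d\<^sub>i \<noteq> 0\<close>.\<close>

definition cppc_lambda ::
  "real^'n^'n \<Rightarrow> real^'n \<Rightarrow> real \<Rightarrow> real \<Rightarrow> 'n \<Rightarrow> real^'n \<Rightarrow> real" where
  "cppc_lambda A b \<rho> \<epsilon> i x =
     (cppc_v A b \<rho> \<epsilon> i x \<bullet> cppc_d A b \<rho> \<epsilon> i x) / (norm (cppc_v A b \<rho> \<epsilon> i x))\<^sup>2"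

definition cppc_next ::
  "real^'n^'n \<Rightarrow> real^'n \<Rightarrow> real \<Rightarrow> real \<Rightarrow> 'n \<Rightarrow> real^'n \<Rightarrow> real^'n" where
  "cppc_next A b \<rho> \<epsilon> i x = x - cppc_lambda A b \<rho> \<epsilon> i x *\<^sub>R cppc_v A b \<rho> \<epsilon> i x"

text \<open>Runs are total sequences of iterates \<open>x k\<close> and chosen indices \<open>ix k\<close>. Iteration \<open>k\<close> is
  reached if no earlier iteration terminated; entries past termination are unconstrained.\<close>

definition cppc_reached ::
  "real^'n^'n \<Rightarrow> real^'n \<Rightarrow> real \<Rightarrow> real \<Rightarrow> (nat \<Rightarrow> real^'n) \<Rightarrow> (nat \<Rightarrow> 'n) \<Rightarrow> nat \<Rightarrow> bool" where
  "cppc_reached A b \<rho> \<epsilon> x ix k \<longleftrightarrow> (\<forall>j<k. residual A b \<rho> \<epsilon> (x j) $ ix j \<noteq> 0)"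

definition cppc_run ::
  "real^'n^'n \<Rightarrow> real^'n \<Rightarrow> real \<Rightarrow> real \<Rightarrow> real^'n \<Rightarrow> (nat \<Rightarrow> real^'n) \<Rightarrow> (nat \<Rightarrow> 'n) \<Rightarrow> bool" where
  "cppc_run A b \<rho> \<epsilon> x0 x ix \<longleftrightarrow>
     x 0 = x0 \<and>
     (\<forall>k. cppc_reached A b \<rho> \<epsilon> x ix k \<longrightarrow>
        is_arg_max (\<lambda>i. \<bar>residual A b \<rho> \<epsilon> (x k) $ i\<bar>) (\<lambda>_. True) (ix k) \<and>
        (residual A b \<rho> \<epsilon> (x k) $ ix k \<noteq> 0 \<longrightarrow>
           x (Suc k) = cppc_next A b \<rho> \<epsilon> (ix k) (x k)))"

end

theory Submission
  imports Defs
begin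

text \<open>\<open>\<Phi>\<close> is monotone because \<open>\<langle>z, A z\<rangle> \<ge> \<parallel>z\<parallel>\<^sup>2\<close> and the componentwise absolute value is
  1-Lipschitz in each coordinate. As \<open>\<Phi>\<close> vanishes at the solution \<open>x\<^sup>*\<close>, monotonicity at \<open>y\<close>
  says that the hyperplane through \<open>y\<close> with normal \<open>v = \<Phi> y\<close> separates \<open>x\<close> from \<open>x\<^sup>*\<close>,
  provided \<open>\<langle>v, d\<rangle> \<ge> 0\<close>; the next iterate is the projection of \<open>x\<close> onto it. The sign of
  \<open>\<langle>v, d\<rangle>\<close> comes from the optimality condition of the proximal step, which gives
  \<open>v\<^sub>i = (1 / \<gamma>\<^sub>i - (a\<^sub>i\<^sub>i - 1)) d\<^sub>i\<close> at the only coordinate where \<open>d\<close> can be nonzero.\<close>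

text \<open>The skew-symmetric part of \<open>A\<close> contributes nothing to the quadratic
  form.\<close>

lemma inner_sym_part: "z \<bullet> (sym_part A *v z) = z \<bullet> (A *v z)"
proof -
  have "z \<bullet> (transpose A *v z) = z \<bullet> (A *v z)"
    by (metis dot_lmul_matrix inner_commute transpose_matrix_vector)
  then show ?thesis
    by (simp add: sym_part_def scaleR_matrix_vector_assoc[symmetric]
        matrix_vector_mult_add_rdistrib inner_add_right)
qed

lemma loewner_ge_sym_part_mat1D:
  assumes "loewner_ge (sym_part A) (mat 1)"
  shows "z \<bullet> z \<le> z \<bullet> (A *v z)"
proof -
  have "0 \<le> z \<bullet> ((sym_part A - mat 1) *v z)"
    using assms by (simp add: loewner_ge_def pos_semidef_def)
  then show ?thesis
    by (simp add: matrix_vector_mult_diff_rdistrib inner_diff_right inner_sym_part)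
qed

lemma Phi_monotone:
  assumes "loewner_ge (sym_part A) (mat 1)"
  shows "0 \<le> (Phi A b y - Phi A b z) \<bullet> (y - z)"
proof -
  have "(\<bar>y\<bar> - \<bar>z\<bar>) \<bullet> (y - z) \<le> (y - z) \<bullet> (y - z)"
    unfolding inner_vec_def
  proof (rule sum_mono)
    fix i
    have "(\<bar>y $ i\<bar> - \<bar>z $ i\<bar>) * (y $ i - z $ i) \<le> \<bar>y $ i - z $ i\<bar> * \<bar>y $ i - z $ i\<bar>"
      by (rule order_trans[OF abs_ge_self])
        (simp add: abs_mult mult_right_mono abs_triangle_ineq3 del: abs_mult_self_eq)
    then show "(\<bar>y\<bar> - \<bar>z\<bar>) $ i \<bullet> (y - z) $ i \<le> (y - z) $ i \<bullet> (y - z) $ i"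
      by (simp add: abs_vec_nth)
  qed
  moreover have "(Phi A b y - Phi A b z) \<bullet> (y - z)
      = (y - z) \<bullet> (A *v (y - z)) - (\<bar>y\<bar> - \<bar>z\<bar>) \<bullet> (y - z)"
    by (simp add: Phi_def matrix_vector_mult_diff_distrib inner_diff_left inner_diff_right
        inner_add_left inner_add_right inner_commute)
  ultimately show ?thesis
    using loewner_ge_sym_part_mat1D[OF assms, of "y - z"] by linarith
qed

lemma gam_pos: "0 < \<rho> \<Longrightarrow> 0 < \<epsilon> \<Longrightarrow> 0 < gam A \<rho> \<epsilon> i"
  by (simp add: gam_def ell_def max_def)

text \<open>Since \<open>1 / gam = ell / \<rho>\<close> and \<open>\<rho> < 1\<close>, the
  reciprocal step size dominates \<open>ell\<close>, which in turn bounds the diagonal term.\<close>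

lemma diag_le_inverse_gam:
  assumes "0 < \<rho>" "\<rho> < 1" "0 < \<epsilon>"
  shows "A $ i $ i - 1 \<le> 1 / gam A \<rho> \<epsilon> i"
proof -
  have "0 < ell A \<epsilon> i" using assms by (simp add: ell_def max_def)
  then have "ell A \<epsilon> i \<le> 1 / gam A \<rho> \<epsilon> i"
    using assms by (simp add: gam_def field_simps)
  then show ?thesis by (simp add: ell_def)
qed

text \<open>Stationarity of the prox objective at its minimiser p: the derivative of
  \<open>g\<close> at p is \<open>-2 * neg_part p\<close>, and
  \<open>2 * neg_part p = \<bar>p\<bar> - p\<close>.\<close>

lemma prox_g_optimality:
  assumes "\<gamma> > 0"
  shows "\<bar>prox \<gamma> g z\<bar> - prox \<gamma> g z = (prox \<gamma> g z - z) / \<gamma>"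
proof (cases "z \<ge> 0")
  case False
  define p where "p = z / (1 + 2 * \<gamma>)"
  have "p < 0"
    using assms False by (simp add: p_def field_simps)
  moreover have "p * (1 + 2 * \<gamma>) = z"
    using assms by (simp add: p_def)
  then have "z = p + 2 * \<gamma> * p"
    by (simp add: algebra_simps)
  moreover have "prox \<gamma> g z = p"
    using assms False by (simp add: prox_g p_def)
  ultimately show ?thesis
    using assms by simp
qed (simp add: prox_g assms)

lemma cppc_d_eq_axis: "cppc_d A b \<rho> \<epsilon> i x = axis i (x $ i - coord_prox A b \<rho> \<epsilon> x i)"
  by (simp add: cppc_d_def cppc_y_def axis_def vec_eq_iff)

lemma cppc_v_nth:
  assumes "0 < \<rho>" "0 < \<epsilon>"
  shows "cppc_v A b \<rho> \<epsilon> i x $ i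
    = (1 / gam A \<rho> \<epsilon> i - (A $ i $ i - 1)) * (x $ i - coord_prox A b \<rho> \<epsilon> x i)"
proof -
  define \<gamma> where "\<gamma> = gam A \<rho> \<epsilon> i"
  define p where "p = coord_prox A b \<rho> \<epsilon> x i"
  have "\<gamma> > 0" using assms by (simp add: \<gamma>_def gam_pos)
  then have opt: "\<bar>p\<bar> - p = F A b x $ i - (x $ i - p) / \<gamma>"
    using prox_g_optimality[of \<gamma> "x $ i - \<gamma> * F A b x $ i"]
    by (simp add: p_def coord_prox_def \<gamma>_def field_simps)
  have y: "cppc_y A b \<rho> \<epsilon> i x = x - axis i (x $ i - p)"
    using cppc_d_eq_axis[of A b \<rho> \<epsilon> i x] by (simp add: cppc_d_def p_def algebra_simps)
  \<comment> \<open>The prox step moves only coordinate i, so row i of \<open>A\<close> enters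
    through its diagonal entry alone.\<close>
  have "(A *v axis i (x $ i - p)) $ i = A $ i $ i * (x $ i - p)"
    by (simp add: matrix_vector_mult_def axis_def if_distrib cong: if_cong)
  then have "cppc_v A b \<rho> \<epsilon> i x $ i = (A *v x) $ i - A $ i $ i * (x $ i - p) - \<bar>p\<bar> - b $ i"
    by (simp add: cppc_v_def Phi_def y matrix_vector_mult_diff_distrib abs_vec_nth)
  moreover have "F A b x $ i = (A *v x) $ i - x $ i - b $ i"
    by (simp add: F_def matrix_vector_mult_diff_rdistrib)
  ultimately show ?thesis
    using opt unfolding \<gamma>_def[symmetric] p_def[symmetric] by (simp add: algebra_simps diff_divide_distrib)
qed

lemma cppc_v_inner_d_nonneg:
  assumes "0 < \<rho>" "\<rho> < 1" "0 < \<epsilon>"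
  shows "0 \<le> cppc_v A b \<rho> \<epsilon> i x \<bullet> cppc_d A b \<rho> \<epsilon> i x"
proof -
  have "0 \<le> 1 / gam A \<rho> \<epsilon> i - (A $ i $ i - 1)"
    using diag_le_inverse_gam[OF assms, of A i] by simp
  \<comment> \<open>As d is supported on coordinate i, the inner product is this factor times a
    square.\<close>
  then show ?thesis
    using assms by (simp add: cppc_d_eq_axis inner_axis cppc_v_nth mult.assoc)
qed

text \<open>With c the coefficient of v, the squared norm expands to \<open>(norm z)\<^sup>2 - 2 * c
  * (v \<bullet> z) + c * (v \<bullet> d)\<close>; as \<open>c \<ge> 0\<close>, replacing
  \<open>v \<bullet> z\<close> by the smaller \<open>v \<bullet> d\<close> gives the bound.\<close>

lemma norm_diff_projection_le:
  fixes v d z :: "'a::real_inner"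
  assumes "0 \<le> v \<bullet> d" "v \<bullet> d \<le> v \<bullet> z"
  shows "(norm (z - ((v \<bullet> d) / (norm v)\<^sup>2) *\<^sub>R v))\<^sup>2 \<le> (norm z)\<^sup>2 - (v \<bullet> d)\<^sup>2 / (norm v)\<^sup>2"
proof (cases "v = 0")
  case False
  define c where "c = (v \<bullet> d) / (norm v)\<^sup>2"
  have cd: "c * (norm v)\<^sup>2 = v \<bullet> d" "c * (v \<bullet> d) = (v \<bullet> d)\<^sup>2 / (norm v)\<^sup>2" "0 \<le> c"
    using False assms(1) by (simp_all add: c_def power2_eq_square)
  have "(norm (z - c *\<^sub>R v))\<^sup>2 = (norm z)\<^sup>2 - 2 * (c * (v \<bullet> z)) + c * (c * (norm v)\<^sup>2)"
    by (simp only: power2_norm_eq_inner) (simp add: inner_diff_left inner_diff_right inner_commute)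
  moreover have "c * (v \<bullet> d) \<le> c * (v \<bullet> z)"
    using assms(2) cd(3) by (rule mult_left_mono)
  ultimately show ?thesis
    unfolding c_def[symmetric] cd(2)[symmetric] by (simp add: cd(1))
\<comment> \<open>For \<open>v = 0\<close> the quotients are 0 and both sides equal
  \<open>(norm z)\<^sup>2\<close>.\<close>
qed simp

lemma cppc_next_fejer:
  assumes "loewner_ge (sym_part A) (mat 1)" "0 < \<rho>" "\<rho> < 1" "0 < \<epsilon>" "xs \<in> solution_set A b"
  shows "(norm (cppc_next A b \<rho> \<epsilon> i x - xs))\<^sup>2 \<le> (norm (x - xs))\<^sup>2
    - (cppc_v A b \<rho> \<epsilon> i x \<bullet> cppc_d A b \<rho> \<epsilon> i x)\<^sup>2 / (norm (cppc_v A b \<rho> \<epsilon> i x))\<^sup>2"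
proof -
  have "0 \<le> cppc_v A b \<rho> \<epsilon> i x \<bullet> (cppc_y A b \<rho> \<epsilon> i x - xs)"
    using Phi_monotone[OF assms(1), of b "cppc_y A b \<rho> \<epsilon> i x" xs] assms(5)
    by (simp add: solution_set_def cppc_v_def)
  \<comment> \<open>Here \<open>x - xs\<close> splits as d plus \<open>y - xs\<close>.\<close>
  then have "cppc_v A b \<rho> \<epsilon> i x \<bullet> cppc_d A b \<rho> \<epsilon> i x \<le> cppc_v A b \<rho> \<epsilon> i x \<bullet> (x - xs)"
    by (simp add: cppc_d_def inner_diff_right)
  from norm_diff_projection_le[OF cppc_v_inner_d_nonneg[OF assms(2-4)] this]
  show ?thesis
    by (simp add: cppc_next_def cppc_lambda_def algebra_simps)
qed

text \<open>A vanishing largest modulus would force the whole vector to vanish. This passes from a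
  nonzero residual vector to the chosen coordinate, on which \<open>cppc_run\<close> conditions the
  update.\<close>

lemma is_arg_max_abs_nonzero:
  fixes r :: "real^'n"
  assumes "is_arg_max (\<lambda>i. \<bar>r $ i\<bar>) (\<lambda>_. True) i" "r \<noteq> 0"
  shows "r $ i \<noteq> 0"
  using assms by (force simp: is_arg_max_linorder vec_eq_iff)

theorem lemma4p2:
  fixes A :: "real^'n^'n" and b x0 xs :: "real^'n" and \<rho> \<epsilon> :: real
    and x :: "nat \<Rightarrow> real^'n" and ix :: "nat \<Rightarrow> 'n" and k :: nat
  assumes "loewner_ge (sym_part A) (mat 1)"
    and "solution_set A b \<noteq> {}"
    and "0 < \<rho>" and "\<rho> < 1" and "\<epsilon> > 0"
    and "cppc_run A b \<rho> \<epsilon> x0 x ix"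
    and "xs \<in> solution_set A b"
    and "cppc_reached A b \<rho> \<epsilon> x ix k"
    and "residual A b \<rho> \<epsilon> (x k) \<noteq> 0"
  shows "(norm (x (Suc k) - xs))\<^sup>2 \<le> (norm (x k - xs))\<^sup>2
    - (cppc_v A b \<rho> \<epsilon> (ix k) (x k) \<bullet> cppc_d A b \<rho> \<epsilon> (ix k) (x k))\<^sup>2
      / (norm (cppc_v A b \<rho> \<epsilon> (ix k) (x k)))\<^sup>2"
proof -
  have "residual A b \<rho> \<epsilon> (x k) $ ix k \<noteq> 0"
    using assms(6,8,9) by (intro is_arg_max_abs_nonzero) (simp_all add: cppc_run_def)
  then have "x (Suc k) = cppc_next A b \<rho> \<epsilon> (ix k) (x k)"
    using assms(6,8) by (simp add: cppc_run_def)
  then show ?thesis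
    using cppc_next_fejer[OF assms(1,3,4,5,7), of "ix k" "x k"] by simp
qed

end
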